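(* Let $d\ge1$, $K_d=\{x\in\mathbf{R}^d:x_i\ge0,\ \sum_{i=1}^dx_i\le1\}$, $a>0$, and for $n\ge1$ define $C_n$ on $\mathscr{L}^1(K_d)$ by $$C_n(f)(x)=\sum_{h\in\{0,\dots,n\}^d,\ |h|\le n}d!\,P^*_{n,h}(x)\int_{K_d}f\Big(\frac{h+au}{n+a}\Big)\,du\qquad(x\in K_d).$$ Then for every $f\in\mathscr{L}^p(K_d)$, $1\le p<+\infty$, $C_n(f)\to f$ in $\mathscr{L}^p(K_d)$ as $n\to\infty$.
   Context: $|h|=h_1+\dots+h_d$, and $P^*_{n,h}(x)=\frac{n!}{h_1!\cdots h_d!(n-|h|)!}x_1^{h_1}\cdots x_d^{h_d}\big(1-\sum_{i=1}^dx_i\big)^{n-|h|}$. $\mathscr{L}^p(K_d)$ and $du$ refer to Lebesgue measure. *)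

theory Defs
  imports "HOL-Analysis.Analysis"
begin

definition simplexK :: "(real^'n::finite) set" where
  "simplexK = {x. (\<forall>i. 0 \<le> x $ i) \<and> (\<Sum>i\<in>UNIV. x $ i) \<le> 1}"

definition multi_idx :: "nat \<Rightarrow> ('n::finite \<Rightarrow> nat) set" where
  "multi_idx n = {h. (\<forall>i. h i \<le> n) \<and> (\<Sum>i\<in>UNIV. h i) \<le> n}"

definition Pstar :: "nat \<Rightarrow> ('n::finite \<Rightarrow> nat) \<Rightarrow> real^'n \<Rightarrow> real" where
  "Pstar n h x =
     fact n / ((\<Prod>i\<in>UNIV. fact (h i)) * fact (n - (\<Sum>i\<in>UNIV. h i)))
     * (\<Prod>i\<in>UNIV. (x $ i) ^ (h i))
     * (1 - (\<Sum>i\<in>UNIV. x $ i)) ^ (n - (\<Sum>i\<in>UNIV. h i))"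

definition Cop :: "real \<Rightarrow> nat \<Rightarrow> (real^'n::finite \<Rightarrow> real) \<Rightarrow> real^'n \<Rightarrow> real" where
  "Cop a n f x =
     (\<Sum>h\<in>multi_idx n. fact CARD('n) * Pstar n h x *
        (LINT u|lebesgue_on simplexK.
           f (\<chi> i. (real (h i) + a * u $ i) / (real n + a))))"

end

theory Submission
  imports Defs
begin

text \<open>
  Each \<open>C\<^sub>n\<close> is a positive operator fixing constants, so Jensen's inequality gives
  \<open>\<bar>C\<^sub>n f\<bar>\<^sup>p \<le> C\<^sub>n (\<bar>f\<bar>\<^sup>p)\<close> on the simplex. The Dirichlet integral gives
  \<open>P\<^sup>*\<^sub>n\<^sub>,\<^sub>h\<close> the integral \<open>n! / (n + d)!\<close> for every \<open>h\<close>, and the images \<open>(h + a K) / (n + a)\<close> of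
  the simplex cover each point at most \<open>(a + 1)\<^sup>d\<close> times; hence the operators are bounded on
  \<open>L\<^sup>p\<close> uniformly in \<open>n\<close>. On continuous functions \<open>C\<^sub>n\<close> converges uniformly, by the variance
  argument familiar from Bernstein polynomials, and continuous functions are dense in \<open>L\<^sup>p\<close>.
\<close>

subsection \<open>Moments of the multinomial weights\<close>

text \<open>The uniform bound is a balance of two powers of n. Pulling the integrals back along u ->
  (h + a u) / (n + a) costs the inverse Jacobian ((n + a) / a)^d, while the integral n! / (n + d)!
  of each weight is at most (n + 1)^(-d); the product stays below ((1 + a) / a)^d. The overlap
  factor (1 + a)^d and the normalisation d! complete the constant d! ((1 + a)^2 / a)^d. Overlaps
  have to be counted because for a > 1 the images of the simplex are no longer essentially disjoint.
  All estimates compare integrals of p-th powers in \<open>ennreal\<close>; the inequality |u + v|^p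
  \<le> 2^p (|u|^p + |v|^p) takes the place of the triangle inequality.\<close>

lemma multinomial_scaled:
  fixes y :: "'a \<Rightarrow> real" and z :: real
  assumes "finite A" "n \<le> N"
  shows "(\<Sum>h\<in>PiE A (\<lambda>_. {..N}). if sum h A \<le> n
            then (\<Prod>i\<in>A. y i ^ h i / fact (h i)) * z ^ (n - sum h A) / fact (n - sum h A) else 0)
         = (sum y A + z) ^ n / fact n"
  using assms
proof (induction A arbitrary: n rule: finite_induct)
  case empty
  then show ?case by simp
next
  case (insert b A)
  \<comment> \<open>With every power divided by its factorial, the factor belonging to
    \<open>b\<close> splits off exactly, and the induction reduces to the binomial theorem in
    \<open>y b\<close> and \<open>sum y A + z\<close>. The index cube \<open>{..N}\<close> stays
    fixed while \<open>n\<close> drops to \<open>n - k\<close>, which is why \<open>n\<close> and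
    \<open>N\<close> are kept apart.\<close>
  let ?T = "\<lambda>A n h. if sum h A \<le> n
            then (\<Prod>i\<in>A. y i ^ h i / fact (h i)) * z ^ (n - sum h A) / fact (n - sum h A) else 0"
  have inj: "inj_on (\<lambda>(k, h). h(b := k)) ({..N} \<times> PiE A (\<lambda>_. {..N}))"
    by (rule inj_combinator[OF insert.hyps(2)])
  have step: "?T (insert b A) n (h(b := k)) =
      (if k \<le> n then y b ^ k / fact k * ?T A (n - k) h else 0)" for h k
  proof -
    have s: "sum (h(b := k)) A = sum h A" "(\<Prod>i\<in>A. y i ^ (h(b := k)) i / fact ((h(b := k)) i))
        = (\<Prod>i\<in>A. y i ^ h i / fact (h i))"
      using insert.hyps by (auto intro!: sum.cong prod.cong)
    show ?thesis
      using insert.hyps by (simp add: s del: fun_upd_apply) (auto simp: diff_diff_left add.commute mult_ac)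
  qed
  have "(\<Sum>h\<in>PiE (insert b A) (\<lambda>_. {..N}). ?T (insert b A) n h)
      = (\<Sum>(k, h)\<in>{..N} \<times> PiE A (\<lambda>_. {..N}). ?T (insert b A) n (h(b := k)))"
    unfolding PiE_insert_eq by (subst sum.reindex[OF inj]) (simp add: case_prod_unfold o_def)
  also have "\<dots> = (\<Sum>k\<le>N. \<Sum>h\<in>PiE A (\<lambda>_. {..N}). if k \<le> n then y b ^ k / fact k * ?T A (n - k) h else 0)"
    unfolding step by (rule sum.cartesian_product[symmetric])
  also have "\<dots> = (\<Sum>k\<le>N. if k \<le> n then y b ^ k / fact k * ((sum y A + z) ^ (n - k) / fact (n - k)) else 0)"
  proof (intro sum.cong refl)
    fix k
    show "(\<Sum>h\<in>PiE A (\<lambda>_. {..N}). if k \<le> n then y b ^ k / fact k * ?T A (n - k) h else 0) =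
      (if k \<le> n then y b ^ k / fact k * ((sum y A + z) ^ (n - k) / fact (n - k)) else 0)"
      using insert.IH[of "n - k"] insert.prems
      by (cases "k \<le> n") (simp_all only: if_True if_False sum_distrib_left[symmetric] sum.neutral_const)
  qed
  also have "\<dots> = (\<Sum>k\<le>n. y b ^ k / fact k * ((sum y A + z) ^ (n - k) / fact (n - k)))"
    using insert.prems by (intro sum.mono_neutral_cong_right) auto
  also have "\<dots> = (\<Sum>k\<le>n. of_nat (n choose k) * y b ^ k * (sum y A + z) ^ (n - k)) / fact n"
    unfolding sum_divide_distrib by (intro sum.cong) (auto simp: binomial_fact)
  also have "\<dots> = (sum y (insert b A) + z) ^ n / fact n"
    using insert.hyps by (simp add: binomial_ring[symmetric] add.assoc)
  finally show ?case .
qed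

lemma finite_multi_idx: "finite (multi_idx n :: ('n::finite \<Rightarrow> nat) set)"
  by (rule finite_subset[of _ "PiE UNIV (\<lambda>_. {..n})"])
     (auto simp: multi_idx_def finite_PiE simp del: PiE_UNIV_domain)

text \<open>Here \<open>y\<close> and \<open>z\<close> are free, not tied by total mass 1: the
  generating function below arises by scaling one of the variables.\<close>

lemma multinomial_multi_idx:
  fixes y :: "'n::finite \<Rightarrow> real"
  shows "(\<Sum>h\<in>multi_idx n. fact n / ((\<Prod>i\<in>UNIV. fact (h i)) * fact (n - sum h UNIV))
            * (\<Prod>i\<in>UNIV. y i ^ h i) * z ^ (n - sum h UNIV)) = (sum y UNIV + z) ^ n"
proof -
  have "(\<Sum>h\<in>multi_idx n. fact n / ((\<Prod>i\<in>UNIV. fact (h i)) * fact (n - sum h UNIV))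
            * (\<Prod>i\<in>UNIV. y i ^ h i) * z ^ (n - sum h UNIV)) =
      fact n * (\<Sum>h\<in>PiE UNIV (\<lambda>_. {..n}). if sum h UNIV \<le> n
            then (\<Prod>i\<in>UNIV. y i ^ h i / fact (h i)) * z ^ (n - sum h UNIV) / fact (n - sum h UNIV) else 0)"
    unfolding sum_distrib_left
    by (rule sum.mono_neutral_cong_left)
       (auto simp: multi_idx_def prod_dividef finite_PiE simp del: PiE_UNIV_domain)
  then show ?thesis
    by (simp add: multinomial_scaled)
qed

lemma sum_Pstar: "(\<Sum>h\<in>multi_idx n. Pstar n h x) = 1"
  unfolding Pstar_def by (subst multinomial_multi_idx) simp

text \<open>Replacing \<open>x $ j\<close> by \<open>x $ j * s\<close> in the multinomial theorem,
  with the slack \<open>1 - sum\<close> of the original point as \<open>z\<close>, attaches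
  \<open>s ^ h j\<close> to each weight. The result is the generating function of a binomial
  distribution, the \<open>j\<close>-th marginal.\<close>

lemma Pstar_generating:
  "(\<Sum>h\<in>multi_idx n. Pstar n h x * s ^ h j) = (1 + x $ j * (s - 1)) ^ n"
proof -
  define y where "y = (\<lambda>i. if i = j then x $ j * s else x $ i)"
  have p: "(\<Prod>i\<in>UNIV. y i ^ h i) = (\<Prod>i\<in>UNIV. (x $ i) ^ h i) * s ^ h j" for h
  proof -
    have "(\<Prod>i\<in>UNIV. y i ^ h i) = (\<Prod>i\<in>UNIV. (x $ i) ^ h i * (if i = j then s ^ h j else 1))"
      by (intro prod.cong) (auto simp: y_def power_mult_distrib)
    then show ?thesis by (simp add: prod.distrib)
  qed
  have "sum y UNIV = (\<Sum>i\<in>UNIV. x $ i + (if i = j then x $ j * (s - 1) else 0))"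
    by (intro sum.cong) (auto simp: y_def algebra_simps)
  then have s: "sum y UNIV = (\<Sum>i\<in>UNIV. x $ i) + x $ j * (s - 1)"
    by (simp add: sum.distrib)
  show ?thesis
    using multinomial_multi_idx[of n y "1 - (\<Sum>i\<in>UNIV. x $ i)"]
    by (simp add: Pstar_def p s mult_ac add.commute)
qed

text \<open>Differentiating the generating function twice at \<open>s = 1\<close> yields the factorial moments.\<close>

lemma Pstar_variance:
  "(\<Sum>h\<in>multi_idx n. Pstar n h x * (real (h j) - real n * x $ j)\<^sup>2) = real n * (x $ j) * (1 - x $ j)"
proof -
  let ?c = "x $ j"
  have d1: "(\<Sum>h\<in>multi_idx n. Pstar n h x * (real (h j) * s ^ (h j - 1))) = real n * (1 + ?c * (s - 1)) ^ (n - 1) * ?c" for s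
  proof (rule DERIV_unique[where x = s])
    show "((\<lambda>s. \<Sum>h\<in>multi_idx n. Pstar n h x * s ^ h j) has_real_derivative
      (\<Sum>h\<in>multi_idx n. Pstar n h x * (real (h j) * s ^ (h j - 1)))) (at s)"
      by (auto intro!: derivative_eq_intros simp: mult_ac)
    show "((\<lambda>s. \<Sum>h\<in>multi_idx n. Pstar n h x * s ^ h j) has_real_derivative
      real n * (1 + ?c * (s - 1)) ^ (n - 1) * ?c) (at s)"
      unfolding Pstar_generating by (auto intro!: derivative_eq_intros)
  qed
  have d2: "(\<Sum>h\<in>multi_idx n. Pstar n h x * (real (h j) * real (h j - 1))) = real n * real (n - 1) * ?c\<^sup>2"
  proof (rule DERIV_unique[where x = 1])
    show "((\<lambda>s. \<Sum>h\<in>multi_idx n. Pstar n h x * (real (h j) * s ^ (h j - 1))) has_real_derivative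
      (\<Sum>h\<in>multi_idx n. Pstar n h x * (real (h j) * real (h j - 1)))) (at 1)"
      by (auto intro!: derivative_eq_intros simp: mult_ac)
    show "((\<lambda>s. \<Sum>h\<in>multi_idx n. Pstar n h x * (real (h j) * s ^ (h j - 1))) has_real_derivative
      real n * real (n - 1) * ?c\<^sup>2) (at 1)"
      unfolding d1 by (auto intro!: derivative_eq_intros simp: power2_eq_square)
  qed
  \<comment> \<open>The subtraction \<open>k - 1\<close> is truncated; at \<open>k = 0\<close> both
    sides vanish because of the factor \<open>real k\<close>.\<close>
  have k: "real k * real (k - 1) = (real k)\<^sup>2 - real k" for k :: nat
    by (cases k) (auto simp: power2_eq_square algebra_simps)
  have m1: "(\<Sum>h\<in>multi_idx n. Pstar n h x * real (h j)) = real n * ?c"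
    using d1[of 1] by simp
  have m2: "(\<Sum>h\<in>multi_idx n. Pstar n h x * (real (h j))\<^sup>2) = ((real n)\<^sup>2 - real n) * ?c\<^sup>2 + real n * ?c"
    using d2 m1 unfolding k by (simp add: right_diff_distrib sum_subtractf)
  have "(\<Sum>h\<in>multi_idx n. Pstar n h x * (real (h j) - real n * ?c)\<^sup>2) =
    (\<Sum>h\<in>multi_idx n. Pstar n h x * (real (h j))\<^sup>2) - 2 * real n * ?c * (\<Sum>h\<in>multi_idx n. Pstar n h x * real (h j))
     + (real n * ?c)\<^sup>2 * (\<Sum>h\<in>multi_idx n. Pstar n h x)"
    unfolding sum_distrib_left sum_subtractf[symmetric] sum.distrib[symmetric]
    by (intro sum.cong) (auto simp: power2_eq_square algebra_simps)
  also have "\<dots> = real n * ?c * (1 - ?c)"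
    unfolding m1 m2 sum_Pstar by (simp add: power2_eq_square algebra_simps)
  finally show ?thesis .
qed

subsection \<open>Dirichlet integrals\<close>

text \<open>Scaled by factorials, powers convolve to powers: the exponents add up with one extra.
  The induction trades a power of \<open>t - x\<close> for a power of \<open>x\<close>, so
  \<open>m\<close> must be arbitrary.\<close>

lemma beta_has_integral:
  assumes "0 \<le> (t::real)"
  shows "((\<lambda>x. x ^ k / fact k * (t - x) ^ m / fact m) has_integral t ^ (k + m + 1) / fact (k + m + 1)) {0..t}"
proof (induction k arbitrary: m)
  case 0
  have "((\<lambda>x. (t - x) ^ m / fact m) has_integral - ((t - t) ^ Suc m / fact (Suc m)) - (- ((t - 0) ^ Suc m / fact (Suc m)))) {0..t}"
    using assms
    by (intro fundamental_theorem_of_calculus)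
       (auto simp flip: has_real_derivative_iff_has_vector_derivative intro!: derivative_eq_intros simp del: power_Suc)
  then show ?case by simp
next
  case (Suc k)
  let ?e = "\<lambda>x. x ^ Suc k / fact (Suc k) * (t - x) ^ Suc m / fact (Suc m)"
  \<comment> \<open>Integration by parts: the integrand is the derivative of \<open>?e\<close>,
    which vanishes at both endpoints.\<close>
  have "((\<lambda>x. x ^ k / fact k * (t - x) ^ Suc m / fact (Suc m) - x ^ Suc k / fact (Suc k) * (t - x) ^ m / fact m)
     has_integral ?e t - ?e 0) {0..t}"
    using assms
    by (intro fundamental_theorem_of_calculus)
       (auto simp flip: has_real_derivative_iff_has_vector_derivative intro!: derivative_eq_intros simp del: power_Suc simp: divide_simps)
  from has_integral_diff[OF Suc.IH[of "Suc m"] this] show ?case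
    by simp
qed

lemma nn_integral_beta:
  assumes "0 \<le> (t::real)"
  shows "(\<integral>\<^sup>+ x. ennreal (if x \<in> {0..t} then x ^ k / fact k * (t - x) ^ m / fact m else 0) \<partial>lborel) =
    ennreal (t ^ (k + m + 1) / fact (k + m + 1))"
proof -
  have "integral\<^sup>N lborel (\<lambda>x. ennreal (x ^ k / fact k * (t - x) ^ m / fact m) * indicator {0..t} x) =
    ennreal (t ^ (k + m + 1) / fact (k + m + 1))"
    using beta_has_integral[OF assms] by (intro nn_integral_has_integral_lebesgue') auto
  moreover have "ennreal (if x \<in> {0..t} then x ^ k / fact k * (t - x) ^ m / fact m else 0) =
      ennreal (x ^ k / fact k * (t - x) ^ m / fact m) * indicator {0..t} x" for x
    by (auto simp: indicator_def)
  ultimately show ?thesis by simp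
qed

text \<open>Fixing the coordinate \<open>b\<close> at \<open>y\<close> leaves a simplex of size
  \<open>t - y\<close>, so the size has to be a variable of the induction. The inner integral is
  again a scaled power, of \<open>t - y\<close>, and the outer one is a Beta integral.\<close>

lemma nn_integral_dirichlet_PiM:
  assumes "finite A" "0 \<le> (t::real)"
  shows "(\<integral>\<^sup>+ x. ennreal (if (\<forall>i\<in>A. 0 \<le> x i) \<and> sum x A \<le> t
            then (\<Prod>i\<in>A. x i ^ h i / fact (h i)) * (t - sum x A) ^ m / fact m else 0) \<partial>Pi\<^sub>M A (\<lambda>_. lborel)) =
     ennreal (t ^ (sum h A + m + card A) / fact (sum h A + m + card A))"
  using assms
proof (induction A arbitrary: t rule: finite_induct)
  case empty
  then show ?case by (simp add: PiM_empty)
next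
  case (insert b A)
  interpret product_sigma_finite "\<lambda>_. lborel" by standard
  let ?M = "\<lambda>A. Pi\<^sub>M A (\<lambda>_. lborel :: real measure)"
  let ?D = "\<lambda>A t x. if (\<forall>i\<in>A. 0 \<le> x i) \<and> sum x A \<le> t
            then (\<Prod>i\<in>A. x i ^ h i / fact (h i)) * (t - sum x A) ^ m / fact m else (0::real)"
  have meas [measurable]: "?D A t \<in> borel_measurable (?M A)" if "finite A" for A :: "'a set" and t
    using that by measurable
  \<comment> \<open>The bound \<open>y \<le> t\<close> is implicit on the left: the remaining
    coordinates are nonnegative and sum to at most \<open>t - y\<close>.\<close>
  have step: "?D (insert b A) t (x(b := y)) =
      (if y \<in> {0..t} then y ^ h b / fact (h b) * ?D A (t - y) x else 0)" for x y
  proof -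
    have s: "sum (x(b := y)) A = sum x A" "(\<Prod>i\<in>A. (x(b := y)) i ^ h i / fact (h i))
        = (\<Prod>i\<in>A. x i ^ h i / fact (h i))" "(\<forall>i\<in>A. 0 \<le> (x(b := y)) i) \<longleftrightarrow> (\<forall>i\<in>A. 0 \<le> x i)"
      using insert.hyps by (auto intro!: sum.cong prod.cong)
    show ?thesis
      using insert.hyps sum_nonneg[of A x]
      by (simp add: s del: fun_upd_apply) (auto simp: diff_diff_eq add_ac mult_ac)
  qed
  have "(\<integral>\<^sup>+ x. ennreal (?D (insert b A) t x) \<partial>?M (insert b A)) =
     (\<integral>\<^sup>+ y. (\<integral>\<^sup>+ x. ennreal (?D (insert b A) t (x(b := y))) \<partial>?M A) \<partial>lborel)"
    using insert.hyps by (intro product_nn_integral_insert_rev) auto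
  also have "\<dots> = (\<integral>\<^sup>+ y. ennreal (if y \<in> {0..t} then y ^ h b / fact (h b) * ((t - y) ^ (sum h A + m + card A) / fact (sum h A + m + card A)) else 0) \<partial>lborel)"
  proof (rule nn_integral_cong)
    fix y :: real
    show "(\<integral>\<^sup>+ x. ennreal (?D (insert b A) t (x(b := y))) \<partial>?M A) =
      ennreal (if y \<in> {0..t} then y ^ h b / fact (h b) * ((t - y) ^ (sum h A + m + card A) / fact (sum h A + m + card A)) else 0)"
    proof (cases "y \<in> {0..t}")
      case True
      then have "(\<integral>\<^sup>+ x. ennreal (?D (insert b A) t (x(b := y))) \<partial>?M A) =
         (\<integral>\<^sup>+ x. ennreal (y ^ h b / fact (h b)) * ennreal (?D A (t - y) x) \<partial>?M A)"
        unfolding step by (intro nn_integral_cong) (auto simp flip: ennreal_mult' simp: mult_ac)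
      also have "\<dots> = ennreal (y ^ h b / fact (h b)) * ennreal ((t - y) ^ (sum h A + m + card A) / fact (sum h A + m + card A))"
        using True insert.hyps by (subst nn_integral_cmult) (auto intro!: measurable_compose[OF _ measurable_ennreal] meas insert.IH arg_cong2[where f = times])
      also have "\<dots> = ennreal (y ^ h b / fact (h b) * ((t - y) ^ (sum h A + m + card A) / fact (sum h A + m + card A)))"
        using True by (intro ennreal_mult'[symmetric]) auto
      finally show ?thesis using True by simp
    next
      case False
      then show ?thesis unfolding step by auto
    qed
  qed
  also have "\<dots> = ennreal (t ^ (sum h (insert b A) + m + card (insert b A)) / fact (sum h (insert b A) + m + card (insert b A)))"
    using nn_integral_beta[OF insert.prems, of "h b" "sum h A + m + card A"] insert.hyps
    unfolding times_divide_eq_right by (simp add: add_ac)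
  finally show ?case .
qed

subsection \<open>Geometry of the simplex and the affine nodes\<close>

lemma closed_simplexK: "closed (simplexK :: (real^'n::finite) set)"
  unfolding simplexK_def
  by (intro closed_Collect_conj closed_Collect_all closed_Collect_le continuous_intros)

lemma simplexK_bounds:
  assumes "x \<in> simplexK"
  shows "0 \<le> x $ i" "x $ i \<le> 1"
proof -
  show 0: "0 \<le> x $ i" using assms by (simp add: simplexK_def)
  have "x $ i \<le> (\<Sum>j\<in>UNIV. x $ j)"
    using assms by (intro member_le_sum) (auto simp: simplexK_def)
  then show "x $ i \<le> 1" using assms by (simp add: simplexK_def)
qed

lemma compact_simplexK: "compact (simplexK :: (real^'n::finite) set)"
proof -
  have "simplexK \<subseteq> cbox (0 :: real^'n) 1"
    using simplexK_bounds by (auto simp: mem_box_cart)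
  then show ?thesis
    using closed_simplexK bounded_cbox bounded_subset compact_eq_bounded_closed by blast
qed

lemma sets_simplexK [measurable]:
  "simplexK \<in> sets borel" "simplexK \<in> sets lborel" "simplexK \<in> sets lebesgue"
  using borel_closed[OF closed_simplexK] by (auto intro!: sets_completionI_sets)

lemma Basis_cart_bij: "bij_betw (\<lambda>i. axis i 1) UNIV (Basis :: (real^'n::finite) set)"
  by (auto simp: bij_betw_def inj_on_def axis_eq_axis Basis_vec_def)

lemma sum_Basis_cart: "sum g (Basis :: (real^'n::finite) set) = (\<Sum>i\<in>UNIV. g (axis i 1))"
  using sum.reindex_bij_betw[OF Basis_cart_bij, of g] by simp

lemma prod_Basis_cart: "prod g (Basis :: (real^'n::finite) set) = (\<Prod>i\<in>UNIV. g (axis i 1))"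
  using prod.reindex_bij_betw[OF Basis_cart_bij, of g] by simp

text \<open>\<open>lborel\<close> is the image of a product measure indexed by \<open>Basis\<close>,
  whereas the simplex is written in coordinates; \<open>axis i 1\<close> translates between the two
  index sets.\<close>

lemma nn_integral_dirichlet_cart:
  fixes h :: "'n::finite \<Rightarrow> nat"
  shows "(\<integral>\<^sup>+ x. ennreal ((\<Prod>i\<in>UNIV. x $ i ^ h i / fact (h i)) * (1 - (\<Sum>i\<in>UNIV. x $ i)) ^ m / fact m)
            * indicator simplexK x \<partial>lborel)
       = ennreal (1 / fact (sum h UNIV + m + CARD('n)))"
proof -
  let ?G = "\<lambda>x :: real^'n. ennreal ((\<Prod>i\<in>UNIV. x $ i ^ h i / fact (h i)) * (1 - (\<Sum>i\<in>UNIV. x $ i)) ^ m / fact m)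
            * indicator simplexK x"
  let ?v = "\<lambda>f :: real^'n \<Rightarrow> real. \<Sum>b\<in>Basis. f b *\<^sub>R b"
  let ?h = "\<lambda>b :: real^'n. h (axis_index b)"
  have G: "?G \<in> borel_measurable borel"
    by measurable
  have v: "?v f $ i = f (axis i 1)" for f i
    by (simp add: cart_eq_inner_axis)
  have all: "(\<forall>b\<in>Basis. P (b :: real^'n)) \<longleftrightarrow> (\<forall>i. P (axis i 1))" for P
    by (auto simp: Basis_vec_def)
  have mem: "?v f \<in> simplexK \<longleftrightarrow> (\<forall>i. 0 \<le> f (axis i 1)) \<and> (\<Sum>i\<in>UNIV. f (axis i 1)) \<le> 1" for f
    unfolding simplexK_def mem_Collect_eq v ..
  have c: "card (Basis :: (real^'n) set) = CARD('n)"
    by simp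
  have "(\<integral>\<^sup>+ x. ?G x \<partial>lborel) = (\<integral>\<^sup>+ f. ?G (?v f) \<partial>Pi\<^sub>M Basis (\<lambda>_. lborel))"
    by (subst lborel_eq) (rule nn_integral_distr, use G in auto)
  also have "\<dots> = (\<integral>\<^sup>+ x. ennreal (if (\<forall>i\<in>Basis. 0 \<le> x i) \<and> sum x Basis \<le> 1
            then (\<Prod>i\<in>Basis. x i ^ ?h i / fact (?h i)) * (1 - sum x Basis) ^ m / fact m else 0) \<partial>Pi\<^sub>M Basis (\<lambda>_. lborel))"
    unfolding v mem indicator_def by (intro nn_integral_cong) (auto simp: sum_Basis_cart prod_Basis_cart all axis_index_axis)
  also have "\<dots> = ennreal (1 ^ (sum ?h Basis + m + card (Basis :: (real^'n) set)) / fact (sum ?h Basis + m + card (Basis :: (real^'n) set)))"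
    by (intro nn_integral_dirichlet_PiM) auto
  finally show ?thesis
    by (simp only: power_one sum_Basis_cart axis_index_axis c)
qed

lemma Pstar_nonneg: "x \<in> simplexK \<Longrightarrow> 0 \<le> Pstar n h x"
  unfolding Pstar_def simplexK_def by (auto intro!: mult_nonneg_nonneg prod_nonneg divide_nonneg_nonneg)

lemma continuous_Pstar: "continuous_on S (Pstar n h)"
  unfolding Pstar_def by (intro continuous_intros)

lemma borel_measurable_Pstar [measurable]: "Pstar n h \<in> borel_measurable borel"
  by (intro borel_measurable_continuous_onI continuous_Pstar)

lemma nn_integral_Pstar:
  fixes h :: "'n::finite \<Rightarrow> nat"
  assumes "h \<in> multi_idx n"
  shows "(\<integral>\<^sup>+ x. ennreal (Pstar n h x) \<partial>lebesgue_on simplexK) = ennreal (fact n / fact (n + CARD('n)))"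
proof -
  let ?m = "n - sum h UNIV"
  let ?D = "\<lambda>x :: real^'n. (\<Prod>i\<in>UNIV. x $ i ^ h i / fact (h i)) * (1 - (\<Sum>i\<in>UNIV. x $ i)) ^ ?m / fact ?m"
  \<comment> \<open>Membership in \<open>multi_idx\<close> makes the natural subtraction exact, so
    the exponents add up to \<open>n\<close> whatever \<open>h\<close> is.\<close>
  have n: "sum h UNIV + ?m = n"
    using assms by (simp add: multi_idx_def)
  have P: "Pstar n h x = fact n * ?D x" for x
    by (simp add: Pstar_def prod_dividef)
  have "(\<integral>\<^sup>+ x. ennreal (Pstar n h x) \<partial>lebesgue_on simplexK)
      = (\<integral>\<^sup>+ x. ennreal (Pstar n h x) * indicator simplexK x \<partial>lebesgue)"
    by (subst nn_integral_restrict_space) auto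
  also have "\<dots> = (\<integral>\<^sup>+ x. ennreal (Pstar n h x) * indicator simplexK x \<partial>lborel)"
    by (subst nn_integral_completion) auto
  also have "\<dots> = (\<integral>\<^sup>+ x. ennreal (fact n) * (ennreal (?D x) * indicator simplexK x) \<partial>lborel)"
    unfolding P by (intro nn_integral_cong) (auto simp flip: ennreal_mult' simp: indicator_def)
  also have "\<dots> = ennreal (fact n) * ennreal (1 / fact (sum h UNIV + ?m + CARD('n)))"
    by (subst nn_integral_cmult) (auto simp only: nn_integral_dirichlet_cart, measurable)
  finally show ?thesis
    unfolding n by (simp add: ennreal_mult'[symmetric])
qed

text \<open>The only weight with \<open>n = 0\<close> is constantly 1, so the volume is a special
  case of the Dirichlet integral. Its reciprocal is the factor \<open>fact CARD('n)\<close> in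
  \<open>Cop\<close>, which thereby averages over the simplex.\<close>

lemma emeasure_simplexK: "emeasure lebesgue (simplexK :: (real^'n::finite) set) = ennreal (1 / fact CARD('n))"
  and measure_simplexK: "measure lebesgue (simplexK :: (real^'n::finite) set) = 1 / fact CARD('n)"
proof -
  have h: "(\<lambda>_::'n. 0) \<in> multi_idx 0" by (simp add: multi_idx_def)
  show *: "emeasure lebesgue (simplexK :: (real^'n) set) = ennreal (1 / fact CARD('n))"
    using nn_integral_Pstar[OF h] by (simp add: Pstar_def emeasure_restrict_space space_restrict_space)
  then show "measure lebesgue (simplexK :: (real^'n) set) = 1 / fact CARD('n)"
    by (simp add: measure_def)
qed

section \<open>Affine copies of the simplex and the multiplicity of their overlap\<close>

definition node :: "real \<Rightarrow> nat \<Rightarrow> ('n::finite \<Rightarrow> nat) \<Rightarrow> real^'n \<Rightarrow> real^'n" where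
  "node a n h u = (\<chi> i. (real (h i) + a * u $ i) / (real n + a))"

lemma Cop_node:
  "Cop a n f x = (\<Sum>h\<in>multi_idx n. fact CARD('n) * Pstar n h x * (LINT u|lebesgue_on simplexK. f (node a n h u)))"
  for f :: "real^'n::finite \<Rightarrow> real"
  by (simp add: Cop_def node_def)

lemma node_in_simplexK:
  assumes "a > 0" "h \<in> multi_idx n" "u \<in> simplexK"
  shows "node a n h u \<in> simplexK"
proof -
  have "(\<Sum>i\<in>UNIV. (real (h i) + a * u $ i) / (real n + a)) = (real (sum h UNIV) + a * (\<Sum>i\<in>UNIV. u $ i)) / (real n + a)"
    by (simp add: sum_divide_distrib[symmetric] sum.distrib sum_distrib_left)
  also have "\<dots> \<le> (real n + a * 1) / (real n + a)"
    using assms by (intro divide_right_mono add_mono mult_left_mono) (auto simp: multi_idx_def simplexK_def simp flip: of_nat_sum)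
  also have "\<dots> = 1" using assms by simp
  finally show ?thesis
    using assms by (auto simp: node_def simplexK_def)
qed

text \<open>The Jacobian stands next to the integral of the composition, so the identity involves no
  division in \<open>ennreal\<close>.\<close>

lemma
  fixes T :: "'a::euclidean_space \<Rightarrow> 'a"
  assumes "c > 0" and T: "T = (\<lambda>u. t + c *\<^sub>R u)"
  shows measurable_lebesgue_affine: "T \<in> lebesgue \<rightarrow>\<^sub>M lebesgue"
    and nn_integral_lebesgue_affine: "w \<in> borel_measurable lebesgue \<Longrightarrow>
      ennreal (c ^ DIM('a)) * (\<integral>\<^sup>+ u. w (T u) \<partial>lebesgue) = (\<integral>\<^sup>+ y. w y \<partial>lebesgue)"
proof -
  \<comment> \<open>The homothety in the coordinatewise form used by
    \<open>lebesgue_affine_euclidean\<close>, with the same factor on every axis.\<close>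
  have T': "T = (\<lambda>x. t + (\<Sum>j\<in>Basis. (c * (x \<bullet> j)) *\<^sub>R j))"
    unfolding T scaleR_scaleR[symmetric] scaleR_sum_right[symmetric] euclidean_representation ..
  show m: "T \<in> lebesgue \<rightarrow>\<^sub>M lebesgue"
    using assms(1) unfolding T' by (intro lebesgue_affine_measurable) auto
  assume w: "w \<in> borel_measurable lebesgue"
  have "(\<integral>\<^sup>+ y. w y \<partial>lebesgue) = (\<integral>\<^sup>+ y. w y \<partial>density (distr lebesgue lebesgue T) (\<lambda>_. (\<Prod>j\<in>(Basis::'a set). \<bar>c\<bar>)))"
    using assms(1) unfolding T' by (subst lebesgue_affine_euclidean[of "\<lambda>_. c" t]) auto
  also have "\<dots> = (\<integral>\<^sup>+ y. ennreal (c ^ DIM('a)) * w y \<partial>distr lebesgue lebesgue T)"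
    using assms(1) w by (subst nn_integral_density) auto
  also have "\<dots> = ennreal (c ^ DIM('a)) * (\<integral>\<^sup>+ y. w y \<partial>distr lebesgue lebesgue T)"
    using w by (intro nn_integral_cmult) auto
  also have "(\<integral>\<^sup>+ y. w y \<partial>distr lebesgue lebesgue T) = (\<integral>\<^sup>+ u. w (T u) \<partial>lebesgue)"
    using w m by (intro nn_integral_distr) auto
  finally show "ennreal (c ^ DIM('a)) * (\<integral>\<^sup>+ u. w (T u) \<partial>lebesgue) = (\<integral>\<^sup>+ y. w y \<partial>lebesgue)" ..
qed

lemma card_nat_interval_le:
  assumes "0 \<le> (a::real)"
  shows "finite {k::nat. s - a \<le> k \<and> k \<le> s}" "real (card {k::nat. s - a \<le> k \<and> k \<le> s}) \<le> a + 1"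
proof -
  have s: "int ` {k::nat. s - a \<le> k \<and> k \<le> s} \<subseteq> {\<lceil>s - a\<rceil>..\<lfloor>s\<rfloor>}"
    by (auto simp: le_floor_iff ceiling_le_iff)
  show "finite {k::nat. s - a \<le> k \<and> k \<le> s}"
    using finite_subset[OF s] by (simp add: finite_image_iff)
  have "card {k::nat. s - a \<le> k \<and> k \<le> s} \<le> card {\<lceil>s - a\<rceil>..\<lfloor>s\<rfloor>}"
    using card_mono[OF _ s] by (simp add: card_image)
  then show "real (card {k::nat. s - a \<le> k \<and> k \<le> s}) \<le> a + 1"
    using assms by simp linarith
qed

text \<open>If \<open>node a n h u = y\<close>, then each \<open>h i\<close> lies in an interval of length \<open>a\<close> determined by \<open>y\<close>.\<close>

lemma card_node_fibre:
  fixes y :: "real^'n::finite"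
  assumes "a > 0"
  shows "real (card {h \<in> multi_idx n. \<exists>u\<in>simplexK. node a n h u = y}) \<le> (a + 1) ^ CARD('n)"
proof -
  let ?I = "\<lambda>i. {k::nat. (real n + a) * y $ i - a \<le> k \<and> k \<le> (real n + a) * y $ i}"
  have "{h \<in> multi_idx n. \<exists>u\<in>simplexK. node a n h u = y} \<subseteq> PiE UNIV ?I"
  proof
    fix h assume "h \<in> {h \<in> multi_idx n. \<exists>u\<in>simplexK. node a n h u = y}"
    then obtain u where u: "u \<in> simplexK" and y: "y = node a n h u"
      by auto
    have "(real n + a) * y $ i = real (h i) + a * u $ i" for i
      using assms by (simp add: y node_def)
    moreover have "0 \<le> a * u $ i" "a * u $ i \<le> a" for i
      using simplexK_bounds[OF u, of i] assms by auto
    ultimately show "h \<in> PiE UNIV ?I"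
      by auto
  qed
  then have "card {h \<in> multi_idx n. \<exists>u\<in>simplexK. node a n h u = y} \<le> card (PiE UNIV ?I)"
    using assms by (intro card_mono finite_PiE card_nat_interval_le) auto
  also have "real (card (PiE UNIV ?I)) = (\<Prod>i\<in>UNIV. real (card (?I i)))"
    by (simp add: card_PiE del: PiE_UNIV_domain)
  also have "\<dots> \<le> (\<Prod>i\<in>(UNIV::'n set). a + 1)"
    using assms by (intro prod_mono) (auto intro: card_nat_interval_le)
  finally show ?thesis by simp
qed

lemma node_affine: "a > 0 \<Longrightarrow> node a n h = (\<lambda>u. (\<chi> i. real (h i) / (real n + a)) + (a / (real n + a)) *\<^sub>R u)"
  by (auto simp: node_def vec_eq_iff fun_eq_iff add_divide_distrib)

lemma measurable_node: "a > 0 \<Longrightarrow> node a n h \<in> lebesgue \<rightarrow>\<^sub>M lebesgue"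
  by (rule measurable_lebesgue_affine[OF _ node_affine]) auto

text \<open>The node map is an injective homothety of ratio \<open>a / (n + a)\<close>. Written with
  the indicator of the image, the integrals for different \<open>h\<close> live on the same space
  and can be added under one integral.\<close>

lemma nn_integral_node:
  fixes h :: "'n::finite \<Rightarrow> nat"
  assumes a: "a > 0" and w: "w \<in> borel_measurable lebesgue"
  shows "(\<integral>\<^sup>+ u. w (node a n h u) \<partial>lebesgue_on simplexK) =
    ennreal (((real n + a) / a) ^ CARD('n)) * (\<integral>\<^sup>+ y. indicator (node a n h ` simplexK) y * w y \<partial>lebesgue)"
    and "node a n h ` simplexK \<in> sets lebesgue"
proof -
  let ?c = "a / (real n + a)"
  have inj: "inj (node a n h)"
    using a by (auto simp: node_def inj_def vec_eq_iff)
  have "compact (node a n h ` simplexK)"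
    unfolding node_affine[OF a] by (intro compact_continuous_image compact_simplexK continuous_intros)
  then show S: "node a n h ` simplexK \<in> sets lebesgue"
    by (simp add: borel_compact)
  have "(\<integral>\<^sup>+ u. w (node a n h u) \<partial>lebesgue_on simplexK) = (\<integral>\<^sup>+ u. w (node a n h u) * indicator simplexK u \<partial>lebesgue)"
    by (subst nn_integral_restrict_space) auto
  also have "\<dots> = (\<integral>\<^sup>+ u. indicator (node a n h ` simplexK) (node a n h u) * w (node a n h u) \<partial>lebesgue)"
    using inj by (intro nn_integral_cong) (auto simp: indicator_def inj_image_mem_iff)
  also have "\<dots> = ennreal (((real n + a) / a) ^ CARD('n)) * (ennreal (?c ^ CARD('n)) * (\<integral>\<^sup>+ u. indicator (node a n h ` simplexK) (node a n h u) * w (node a n h u) \<partial>lebesgue))"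
    using a by (simp add: mult.assoc[symmetric] ennreal_mult'[symmetric] power_mult_distrib[symmetric])
  also have "ennreal (?c ^ CARD('n)) * (\<integral>\<^sup>+ u. indicator (node a n h ` simplexK) (node a n h u) * w (node a n h u) \<partial>lebesgue)
     = (\<integral>\<^sup>+ y. indicator (node a n h ` simplexK) y * w y \<partial>lebesgue)"
    using a w S nn_integral_lebesgue_affine[OF _ node_affine[OF a, of n h], where w = "\<lambda>y. indicator (node a n h ` simplexK) y * w y"]
    by (simp del: power_divide)
  finally show "(\<integral>\<^sup>+ u. w (node a n h u) \<partial>lebesgue_on simplexK) =
    ennreal (((real n + a) / a) ^ CARD('n)) * (\<integral>\<^sup>+ y. indicator (node a n h ` simplexK) y * w y \<partial>lebesgue)" .
qed

text \<open>Under the common integral, the sum of the indicators at \<open>y\<close> is the number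
  of copies containing \<open>y\<close>, which \<open>card_node_fibre\<close> bounds by
  \<open>(a + 1) ^ CARD('n)\<close>.\<close>

lemma sum_nn_integral_node_le:
  fixes w :: "real^'n::finite \<Rightarrow> ennreal"
  assumes a: "a > 0" and w[measurable]: "w \<in> borel_measurable lebesgue"
  shows "(\<Sum>h\<in>multi_idx n. \<integral>\<^sup>+ u. w (node a n h u) \<partial>lebesgue_on simplexK) \<le>
    ennreal (((real n + a) * (a + 1) / a) ^ CARD('n)) * (\<integral>\<^sup>+ y. w y \<partial>lebesgue_on simplexK)"
proof -
  note [measurable] = nn_integral_node(2)[OF a w]
  let ?S = "\<lambda>h. node a n h ` simplexK"
  have le: "(\<Sum>h\<in>multi_idx n. indicator (?S h) y * w y) \<le> ennreal ((a + 1) ^ CARD('n)) * (w y * indicator simplexK y)" for y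
  proof (cases "y \<in> simplexK")
    case True
    have "(\<Sum>h\<in>multi_idx n. indicator (?S h) y * w y) = of_nat (card {h \<in> multi_idx n. y \<in> ?S h}) * w y"
      by (simp add: indicator_def sum.If_cases finite_multi_idx if_distrib Int_def flip: sum_distrib_right cong: if_cong)
    also have "{h \<in> multi_idx n. y \<in> ?S h} = {h \<in> multi_idx n. \<exists>u\<in>simplexK. node a n h u = y}"
      by auto
    also have "of_nat (card \<dots>) * w y \<le> ennreal ((a + 1) ^ CARD('n)) * w y"
      using card_node_fibre[OF a, of n y] by (intro mult_right_mono) (auto simp: ennreal_of_nat_eq_real_of_nat intro: ennreal_leI)
    finally show ?thesis using True by simp
  next
    case False
    \<comment> \<open>Copies of the simplex never leave it, so the right-hand integral can be taken
      over the simplex alone.\<close>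
    then have "y \<notin> ?S h" if "h \<in> multi_idx n" for h
      using node_in_simplexK[OF a that] by auto
    then show ?thesis using False by simp
  qed
  have "(\<Sum>h\<in>multi_idx n. \<integral>\<^sup>+ u. w (node a n h u) \<partial>lebesgue_on simplexK) =
     ennreal (((real n + a) / a) ^ CARD('n)) * (\<Sum>h\<in>multi_idx n. \<integral>\<^sup>+ y. indicator (?S h) y * w y \<partial>lebesgue)"
    by (simp add: nn_integral_node[OF a w] sum_distrib_left)
  also have "\<dots> = ennreal (((real n + a) / a) ^ CARD('n)) * (\<integral>\<^sup>+ y. (\<Sum>h\<in>multi_idx n. indicator (?S h) y * w y) \<partial>lebesgue)"
    by (subst nn_integral_sum) auto
  also have "\<dots> \<le> ennreal (((real n + a) / a) ^ CARD('n)) * (\<integral>\<^sup>+ y. ennreal ((a + 1) ^ CARD('n)) * (w y * indicator simplexK y) \<partial>lebesgue)"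
    using le by (intro mult_left_mono nn_integral_mono) auto
  also have "\<dots> = ennreal (((real n + a) / a) ^ CARD('n)) * (ennreal ((a + 1) ^ CARD('n)) * (\<integral>\<^sup>+ y. w y \<partial>lebesgue_on simplexK))"
    by (subst nn_integral_cmult) (auto simp: nn_integral_restrict_space)
  also have "\<dots> = ennreal (((real n + a) * (a + 1) / a) ^ CARD('n)) * (\<integral>\<^sup>+ y. w y \<partial>lebesgue_on simplexK)"
    using a by (simp add: mult.assoc[symmetric] ennreal_mult'[symmetric] power_mult_distrib[symmetric])
  finally show ?thesis .
qed

subsection \<open>Positivity, uniform boundedness and convergence on continuous functions\<close>

text \<open>A supporting line at \<open>m\<close>. For \<open>m > 0\<close> its slope is the
  derivative: on positive \<open>t\<close> convexity applies, and for \<open>t \<le> 0\<close> the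
  line is already nonpositive since \<open>p \<ge> 1\<close>. Negative \<open>m\<close> is the
  mirror image, and at \<open>m = 0\<close> slope 0 serves even for \<open>p = 1\<close>, where the
  function has a kink.\<close>

lemma abs_powr_tangent:
  fixes m p :: real
  assumes "1 \<le> p"
  shows "\<exists>c. \<forall>t. \<bar>m\<bar> powr p + c * (t - m) \<le> \<bar>t\<bar> powr p"
proof -
  have pos: "m powr p + (p * m powr (p - 1)) * (t - m) \<le> \<bar>t\<bar> powr p" if "0 < m" for m t :: real
  proof (cases "0 < t")
    case True
    have "p * m powr (p - 1) * (t - m) \<le> t powr p - m powr p"
      using that True assms
      by (intro convex_on_imp_above_tangent[OF powr_convex[OF assms]])
         (auto intro!: derivative_eq_intros simp: interior_open)
    then show ?thesis using True by simp
  next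
    case False
    have m: "m powr (p - 1) * m = m powr p"
      using that by (simp add: powr_diff)
    have "(p * m powr (p - 1)) * (t - m) \<le> (p * m powr (p - 1)) * (- m)"
      using False assms by (intro mult_left_mono) auto
    also have "\<dots> = - (p * m powr p)"
      using m by (simp add: algebra_simps)
    also have "\<dots> \<le> - (1 * m powr p)"
      using assms by (intro le_imp_neg_le mult_right_mono) auto
    finally show ?thesis by (smt (verit) powr_ge_zero)
  qed
  consider "m = 0" | "m > 0" | "m < 0" by linarith
  then show ?thesis
  proof cases
    case 1
    then show ?thesis by (intro exI[of _ 0]) auto
  next
    case 2
    then show ?thesis using pos[of m] by auto
  next
    case 3
    have "\<bar>m\<bar> powr p + - (p * (- m) powr (p - 1)) * (t - m) \<le> \<bar>t\<bar> powr p" for t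
      using pos[of "- m" "- t"] 3 by (simp add: algebra_simps)
    then show ?thesis by blast
  qed
qed

text \<open>The modulus of the sum is at most twice the larger modulus, and the power of a maximum
  is at most the sum of the powers.\<close>

lemma abs_add_powr_le:
  fixes u v p :: real
  assumes "0 \<le> p"
  shows "\<bar>u + v\<bar> powr p \<le> 2 powr p * (\<bar>u\<bar> powr p + \<bar>v\<bar> powr p)"
proof -
  have "\<bar>u + v\<bar> powr p \<le> (2 * max \<bar>u\<bar> \<bar>v\<bar>) powr p"
    using assms by (intro powr_mono2) auto
  also have "\<dots> = 2 powr p * (max \<bar>u\<bar> \<bar>v\<bar>) powr p"
    by (simp add: powr_mult)
  also have "(max \<bar>u\<bar> \<bar>v\<bar>) powr p \<le> \<bar>u\<bar> powr p + \<bar>v\<bar> powr p"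
    by (simp add: max_def)
  finally show ?thesis by simp
qed

section \<open>Integrability on the simplex and along the nodes\<close>

lemma integrable_compact_continuous:
  fixes g :: "'a::euclidean_space \<Rightarrow> real"
  assumes "compact S" "continuous_on S g"
  shows "integrable (lebesgue_on S) g"
proof -
  have S: "S \<in> sets lebesgue"
    using borel_compact[OF assms(1)] by (auto intro!: sets_completionI_sets)
  have "integrable lborel (\<lambda>x. indicator S x *\<^sub>R g x)"
    by (rule borel_integrable_compact) fact+
  then have "integrable lebesgue (\<lambda>x. indicator S x *\<^sub>R g x)"
    by (subst integrable_completion) auto
  then show ?thesis
    using S by (subst integrable_restrict_space) auto
qed

lemma space_simplexK: "space (lebesgue_on (simplexK :: (real^'n::finite) set)) = simplexK"
  by (simp add: space_restrict_space)

lemma finite_measure_simplexK: "finite_measure (lebesgue_on (simplexK :: (real^'n::finite) set))"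
  by (intro finite_measureI) (simp add: space_simplexK emeasure_restrict_space emeasure_simplexK)

lemma integrable_simplexK_const [simp]:
  "integrable (lebesgue_on (simplexK :: (real^'n::finite) set)) (\<lambda>_. c :: real)"
  by (rule finite_measure.integrable_const[OF finite_measure_simplexK])

lemma integral_simplexK_const:
  "(LINT u|lebesgue_on (simplexK :: (real^'n::finite) set). c :: real) = c / fact CARD('n)"
  by (simp add: space_simplexK measure_restrict_space measure_simplexK)

text \<open>\<open>g\<close> is known to be measurable only on the simplex, so it is extended by 0
  before composing. Lebesgue measurability survives the composition because the node map is
  measurable from \<open>lebesgue\<close> to \<open>lebesgue\<close>.\<close>

lemma borel_measurable_node:
  fixes g :: "real^'n::finite \<Rightarrow> real"
  assumes a: "a > 0" and h: "h \<in> multi_idx n" and g: "g \<in> borel_measurable (lebesgue_on simplexK)"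
  shows "(\<lambda>u. g (node a n h u)) \<in> borel_measurable (lebesgue_on simplexK)"
proof -
  let ?G = "\<lambda>y. if y \<in> simplexK then g y else 0"
  have "?G \<in> borel_measurable lebesgue"
    using g by (simp add: borel_measurable_if)
  then have "(\<lambda>u. ?G (node a n h u)) \<in> borel_measurable (lebesgue_on simplexK)"
    by (intro measurable_restrict_space1 measurable_compose[OF measurable_node[OF a]])
  also have "?this \<longleftrightarrow> ?thesis"
    using node_in_simplexK[OF a h] by (intro measurable_cong) (auto simp: space_simplexK)
  finally show ?thesis .
qed

lemma sum_nn_integral_node_simplexK_le:
  fixes g :: "real^'n::finite \<Rightarrow> real"
  assumes a: "a > 0" and g: "g \<in> borel_measurable (lebesgue_on simplexK)"
  shows "(\<Sum>h\<in>multi_idx n. \<integral>\<^sup>+ u. ennreal (g (node a n h u)) \<partial>lebesgue_on simplexK) \<le>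
    ennreal (((real n + a) * (a + 1) / a) ^ CARD('n)) * (\<integral>\<^sup>+ y. ennreal (g y) \<partial>lebesgue_on simplexK)"
proof -
  let ?G = "\<lambda>y. if y \<in> simplexK then g y else 0"
  have "?G \<in> borel_measurable lebesgue"
    using g by (simp add: borel_measurable_if)
  then have w: "(\<lambda>y. ennreal (?G y)) \<in> borel_measurable lebesgue"
    by measurable
  have "(\<Sum>h\<in>multi_idx n. \<integral>\<^sup>+ u. ennreal (g (node a n h u)) \<partial>lebesgue_on simplexK) =
     (\<Sum>h\<in>multi_idx n. \<integral>\<^sup>+ u. ennreal (?G (node a n h u)) \<partial>lebesgue_on simplexK)"
    using node_in_simplexK[OF a] by (intro sum.cong nn_integral_cong) (auto simp: space_simplexK)
  also note sum_nn_integral_node_le[OF a w]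
  also have "(\<integral>\<^sup>+ y. ennreal (?G y) \<partial>lebesgue_on simplexK) = (\<integral>\<^sup>+ y. ennreal (g y) \<partial>lebesgue_on simplexK)"
    by (intro nn_integral_cong) (auto simp: space_simplexK)
  finally show ?thesis .
qed

text \<open>The integral for one \<open>h\<close> is a summand of the overlap estimate, all of whose
  terms are nonnegative. Additivity and monotonicity of \<open>Cop\<close> depend on this, as the
  Bochner integral of a non-integrable function defaults to 0.\<close>

lemma integrable_node:
  fixes g :: "real^'n::finite \<Rightarrow> real"
  assumes a: "a > 0" and h: "h \<in> multi_idx n" and g: "integrable (lebesgue_on simplexK) g"
  shows "integrable (lebesgue_on simplexK) (\<lambda>u. g (node a n h u))"
proof (rule integrableI_bounded)
  show "(\<lambda>u. g (node a n h u)) \<in> borel_measurable (lebesgue_on simplexK)"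
    using g by (intro borel_measurable_node a h) auto
  have "(\<integral>\<^sup>+ u. ennreal (norm (g (node a n h u))) \<partial>lebesgue_on simplexK) \<le>
     (\<Sum>h\<in>multi_idx n. \<integral>\<^sup>+ u. ennreal (norm (g (node a n h u))) \<partial>lebesgue_on simplexK)"
    by (rule member_le_sum[OF h]) (auto simp: finite_multi_idx)
  also have "\<dots> \<le> ennreal (((real n + a) * (a + 1) / a) ^ CARD('n)) * (\<integral>\<^sup>+ y. ennreal (norm (g y)) \<partial>lebesgue_on simplexK)"
    using g by (intro sum_nn_integral_node_simplexK_le[OF a]) auto
  also have "\<dots> < \<infinity>"
    using g by (simp add: integrable_iff_bounded ennreal_mult_less_top)
  finally show "(\<integral>\<^sup>+ u. ennreal (norm (g (node a n h u))) \<partial>lebesgue_on simplexK) < \<infinity>" .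
qed

text \<open>On a set of finite measure \<open>L^p\<close> lies in \<open>L^1\<close>, so the
  operators apply to every \<open>f\<close> of the theorem.\<close>

lemma integrable_of_powr:
  fixes f :: "real^'n::finite \<Rightarrow> real"
  assumes "1 \<le> p" "f \<in> borel_measurable (lebesgue_on simplexK)"
    and "integrable (lebesgue_on simplexK) (\<lambda>x. \<bar>f x\<bar> powr p)"
  shows "integrable (lebesgue_on simplexK) f"
proof (rule Bochner_Integration.integrable_bound)
  show "integrable (lebesgue_on simplexK) (\<lambda>x. 1 + \<bar>f x\<bar> powr p)"
    using assms by auto
  have "\<bar>t\<bar> \<le> 1 + \<bar>t\<bar> powr p" for t :: real
    using powr_mono[of 1 p "\<bar>t\<bar>"] assms(1) by (cases "\<bar>t\<bar> \<ge> 1") (auto simp: add_increasing2)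
  then show "AE x in lebesgue_on simplexK. norm (f x) \<le> norm (1 + \<bar>f x\<bar> powr p)"
    by (intro AE_I2) (simp add: abs_of_nonneg)
qed fact

section \<open>The operators as positive linear functionals at a point\<close>

context
  fixes a :: real
  assumes a: "a > 0"
begin

lemma Cop_add:
  fixes f g :: "real^'n::finite \<Rightarrow> real"
  assumes "integrable (lebesgue_on simplexK) f" "integrable (lebesgue_on simplexK) g"
  shows "Cop a n (\<lambda>y. f y + g y) x = Cop a n f x + Cop a n g x"
  unfolding Cop_node sum.distrib[symmetric]
  by (intro sum.cong) (auto simp: Bochner_Integration.integral_add integrable_node[OF a] assms algebra_simps)

lemma Cop_cmult: "Cop a n (\<lambda>y. c * f y) x = c * Cop a n f x"
  for f :: "real^'n::finite \<Rightarrow> real"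
  unfolding Cop_node sum_distrib_left by (simp add: mult_ac)

lemma Cop_const: "Cop a n (\<lambda>_. c) x = c"
  for x :: "real^'n::finite"
  unfolding Cop_node integral_simplexK_const
  by (simp add: sum_distrib_right[symmetric] sum_Pstar)

text \<open>The bound may depend on \<open>h\<close> but not on \<open>u\<close>: the averaging
  disappears and only moments of the weights remain to be estimated.\<close>

lemma Cop_le:
  fixes f :: "real^'n::finite \<Rightarrow> real"
  assumes "integrable (lebesgue_on simplexK) f" and x: "x \<in> simplexK"
    and le: "\<And>h u. h \<in> multi_idx n \<Longrightarrow> u \<in> simplexK \<Longrightarrow> f (node a n h u) \<le> b h"
  shows "Cop a n f x \<le> (\<Sum>h\<in>multi_idx n. Pstar n h x * b h)"
  unfolding Cop_node
proof (rule sum_mono)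
  fix h :: "'n \<Rightarrow> nat" assume h: "h \<in> multi_idx n"
  have "(LINT u|lebesgue_on simplexK. f (node a n h u)) \<le> (LINT u|lebesgue_on (simplexK :: (real^'n) set). b h)"
    using integrable_node[OF a h assms(1)] le[OF h] by (intro integral_mono) (auto simp: space_simplexK)
  then have "fact CARD('n) * Pstar n h x * (LINT u|lebesgue_on simplexK. f (node a n h u)) \<le>
     fact CARD('n) * Pstar n h x * (b h / fact CARD('n))"
    unfolding integral_simplexK_const using Pstar_nonneg[OF x] by (intro mult_left_mono) auto
  then show "fact CARD('n) * Pstar n h x * (LINT u|lebesgue_on simplexK. f (node a n h u)) \<le> Pstar n h x * b h"
    by simp
qed

lemma Cop_mono:
  fixes f g :: "real^'n::finite \<Rightarrow> real"
  assumes "integrable (lebesgue_on simplexK) f" "integrable (lebesgue_on simplexK) g" and x: "x \<in> simplexK"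
    and le: "\<And>y. y \<in> simplexK \<Longrightarrow> f y \<le> g y"
  shows "Cop a n f x \<le> Cop a n g x"
  unfolding Cop_node
  using Pstar_nonneg[OF x] node_in_simplexK[OF a]
  by (intro sum_mono mult_left_mono integral_mono integrable_node[OF a] assms) (auto simp: space_simplexK)

lemma continuous_Cop: "continuous_on S (Cop a n f)"
  for f :: "real^'n::finite \<Rightarrow> real"
  unfolding Cop_node by (intro continuous_intros continuous_Pstar)

lemma borel_measurable_Cop: "Cop a n f \<in> borel_measurable (lebesgue_on simplexK)"
  for f :: "real^'n::finite \<Rightarrow> real"
  using borel_measurable_continuous_onI[OF continuous_Cop[of UNIV n f]]
  by (intro measurable_restrict_space1 measurable_completion) auto

text \<open>Jensen's inequality: apply the positive functional \<open>f \<mapsto> Cop a n f x\<close> to a supporting line.\<close>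

lemma Cop_powr_le:
  fixes f :: "real^'n::finite \<Rightarrow> real"
  assumes p: "1 \<le> p" and f: "f \<in> borel_measurable (lebesgue_on simplexK)"
    and fp: "integrable (lebesgue_on simplexK) (\<lambda>x. \<bar>f x\<bar> powr p)" and x: "x \<in> simplexK"
  shows "\<bar>Cop a n f x\<bar> powr p \<le> Cop a n (\<lambda>y. \<bar>f y\<bar> powr p) x"
proof -
  let ?m = "Cop a n f x"
  obtain c where c: "\<And>t. \<bar>?m\<bar> powr p + c * (t - ?m) \<le> \<bar>t\<bar> powr p"
    using abs_powr_tangent[OF p] by blast
  have c': "(\<bar>?m\<bar> powr p - c * ?m) + c * f y \<le> \<bar>f y\<bar> powr p" for y
    using c[of "f y"] by (simp add: algebra_simps)
  have int: "integrable (lebesgue_on simplexK) f"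
    by (rule integrable_of_powr[OF p f fp])
  have "\<bar>?m\<bar> powr p = (\<bar>?m\<bar> powr p - c * ?m) + c * ?m"
    by simp
  also have "\<dots> = Cop a n (\<lambda>y. (\<bar>?m\<bar> powr p - c * ?m) + c * f y) x"
    using int by (subst Cop_add) (auto simp: Cop_const Cop_cmult)
  also have "\<dots> \<le> Cop a n (\<lambda>y. \<bar>f y\<bar> powr p) x"
    using int by (intro Cop_mono fp x c') auto
  finally show ?thesis .
qed

text \<open>In \<open>((1 + a)^2 / a)\<close>, one factor \<open>1 + a\<close> comes from the
  overlap, the other from comparing \<open>n + a\<close> with \<open>n + 1\<close>, and
  \<open>1 / a\<close> from the Jacobian.\<close>

lemma nn_integral_Cop_le:
  fixes g :: "real^'n::finite \<Rightarrow> real"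
  assumes g: "integrable (lebesgue_on simplexK) g" and nn: "\<And>y. 0 \<le> g y"
  shows "(\<integral>\<^sup>+ x. ennreal (Cop a n g x) \<partial>lebesgue_on simplexK) \<le>
    ennreal (fact CARD('n) * ((1 + a)\<^sup>2 / a) ^ CARD('n)) * (\<integral>\<^sup>+ y. ennreal (g y) \<partial>lebesgue_on simplexK)"
proof -
  let ?d = "CARD('n)"
  let ?I = "\<lambda>h. LINT u|lebesgue_on simplexK. g (node a n h u)"
  have I: "0 \<le> ?I h" for h
    using nn by (intro Bochner_Integration.integral_nonneg) auto
  \<comment> \<open>Each of the \<open>k\<close> factors added to \<open>fact n\<close> is at least
    \<open>n + 1\<close>.\<close>
  have fact_le: "fact n * (real n + 1) ^ k \<le> fact (n + k)" for k
  proof (induction k)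
    case (Suc k)
    have "fact n * (real n + 1) ^ Suc k = (real n + 1) * (fact n * (real n + 1) ^ k)"
      by simp
    also have "\<dots> \<le> (real (Suc (n + k))) * fact (n + k)"
      using Suc by (intro mult_mono) auto
    finally show ?case by simp
  qed simp
  have const: "fact ?d * (fact n / fact (n + ?d)) * ((real n + a) * (a + 1) / a) ^ ?d \<le> fact ?d * ((1 + a)\<^sup>2 / a) ^ ?d"
  proof -
    \<comment> \<open>Valid from \<open>n = 0\<close> on, so the final constant is free of
      \<open>n\<close>.\<close>
    have "(real n + a) \<le> (1 + a) * (real n + 1)"
      using a by (simp add: algebra_simps)
    then have "(real n + a) * (a + 1) / a \<le> ((1 + a) * (real n + 1)) * (a + 1) / a"
      using a by (intro divide_right_mono mult_right_mono) auto
    also have "\<dots> = (1 + a)\<^sup>2 / a * (real n + 1)"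
      by (simp add: power2_eq_square algebra_simps)
    finally have "((real n + a) * (a + 1) / a) ^ ?d \<le> ((1 + a)\<^sup>2 / a * (real n + 1)) ^ ?d"
      using a by (intro power_mono) auto
    then have "fact n / fact (n + ?d) * ((real n + a) * (a + 1) / a) ^ ?d \<le>
       fact n / fact (n + ?d) * (((1 + a)\<^sup>2 / a) ^ ?d * (real n + 1) ^ ?d)"
      unfolding power_mult_distrib by (intro mult_left_mono) auto
    also have "\<dots> = ((1 + a)\<^sup>2 / a) ^ ?d * (fact n * (real n + 1) ^ ?d / fact (n + ?d))"
      by simp
    also have "\<dots> \<le> ((1 + a)\<^sup>2 / a) ^ ?d * 1"
      using a fact_le[of ?d] by (intro mult_left_mono) auto
    finally show ?thesis
      unfolding mult.assoc by (intro mult_left_mono) auto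
  qed
  have "(\<integral>\<^sup>+ x. ennreal (Cop a n g x) \<partial>lebesgue_on simplexK) =
     (\<integral>\<^sup>+ x. (\<Sum>h\<in>multi_idx n. ennreal (fact ?d * ?I h) * ennreal (Pstar n h x)) \<partial>lebesgue_on simplexK)"
    using I by (intro nn_integral_cong)
      (auto simp: Cop_node space_simplexK Pstar_nonneg ennreal_mult'[symmetric] mult_ac sum_ennreal)
  also have "\<dots> = (\<Sum>h\<in>multi_idx n. ennreal (fact ?d * ?I h) * ennreal (fact n / fact (n + ?d)))"
  proof -
    have [measurable]: "(\<lambda>x. ennreal (Pstar n h x)) \<in> borel_measurable (lebesgue_on simplexK)" for h :: "'n \<Rightarrow> nat"
      using borel_measurable_Pstar by (intro measurable_restrict_space1 measurable_completion) auto
    show ?thesis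
      by (subst nn_integral_sum) (auto simp: nn_integral_cmult nn_integral_Pstar intro!: sum.cong)
  qed
  also have "\<dots> = ennreal (fact ?d * (fact n / fact (n + ?d))) * (\<Sum>h\<in>multi_idx n. ennreal (?I h))"
    unfolding sum_distrib_left using I by (intro sum.cong) (auto simp: ennreal_mult'[symmetric] mult_ac)
  also have "(\<Sum>h\<in>multi_idx n. ennreal (?I h)) = (\<Sum>h\<in>multi_idx n. \<integral>\<^sup>+ u. ennreal (g (node a n h u)) \<partial>lebesgue_on simplexK)"
    using nn by (intro sum.cong nn_integral_eq_integral[symmetric] integrable_node[OF a] g) auto
  also have "ennreal (fact ?d * (fact n / fact (n + ?d))) * \<dots> \<le> ennreal (fact ?d * (fact n / fact (n + ?d))) *
     (ennreal (((real n + a) * (a + 1) / a) ^ ?d) * (\<integral>\<^sup>+ y. ennreal (g y) \<partial>lebesgue_on simplexK))"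
    using g by (intro mult_left_mono sum_nn_integral_node_simplexK_le[OF a]) auto
  also have "\<dots> = ennreal (fact ?d * (fact n / fact (n + ?d)) * ((real n + a) * (a + 1) / a) ^ ?d) * (\<integral>\<^sup>+ y. ennreal (g y) \<partial>lebesgue_on simplexK)"
    using a by (simp only: mult.assoc[symmetric]) (subst ennreal_mult, auto)
  also have "\<dots> \<le> ennreal (fact ?d * ((1 + a)\<^sup>2 / a) ^ ?d) * (\<integral>\<^sup>+ y. ennreal (g y) \<partial>lebesgue_on simplexK)"
    using const by (intro mult_right_mono ennreal_leI) auto
  finally show ?thesis .
qed

text \<open>The second moment about \<open>x\<close> decays like 1/n uniformly in \<open>x\<close>.
  Each coordinate of the deviation combines the multinomial fluctuation, of variance at most
  \<open>n\<close>, with a shift of size at most \<open>a\<close> due to averaging over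
  \<open>u\<close>.\<close>

lemma Cop_dist_square_le:
  fixes x :: "real^'n::finite"
  assumes x: "x \<in> simplexK"
  shows "Cop a n (\<lambda>y. (dist y x)\<^sup>2) x \<le> real CARD('n) * (2 * (1 + a) / (real n + a))"
proof -
  let ?b = "\<lambda>h. \<Sum>i\<in>(UNIV::'n set). 2 * ((real (h i) - real n * x $ i)\<^sup>2 + a\<^sup>2) / (real n + a)\<^sup>2"
  have int: "integrable (lebesgue_on simplexK) (\<lambda>y. (dist y x)\<^sup>2)"
    by (intro integrable_compact_continuous compact_simplexK continuous_intros)
  have "Cop a n (\<lambda>y. (dist y x)\<^sup>2) x \<le> (\<Sum>h\<in>multi_idx n. Pstar n h x * ?b h)"
  proof (rule Cop_le[OF int x])
    fix h :: "'n \<Rightarrow> nat" and u :: "real^'n"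
    assume u: "u \<in> simplexK"
    have "(dist (node a n h u) x)\<^sup>2 = (\<Sum>i\<in>UNIV. (node a n h u $ i - x $ i)\<^sup>2)"
      by (simp add: dist_norm norm_vec_def L2_set_def sum_nonneg)
    also have "\<dots> \<le> ?b h"
    proof (rule sum_mono)
      fix i
      have eq: "node a n h u $ i - x $ i = ((real (h i) - real n * x $ i) + a * (u $ i - x $ i)) / (real n + a)"
        using a by (simp add: node_def field_simps)
      have sq: "(r + s)\<^sup>2 \<le> 2 * (r\<^sup>2 + s\<^sup>2)" for r s :: real
        using zero_le_power2[of "r - s"] by (simp add: power2_eq_square algebra_simps)
      have "\<bar>u $ i - x $ i\<bar> \<le> 1"
        using simplexK_bounds[OF u, of i] simplexK_bounds[OF x, of i] by auto
      then have "(u $ i - x $ i)\<^sup>2 \<le> 1"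
        by (simp add: abs_square_le_1)
      then have "(a * (u $ i - x $ i))\<^sup>2 \<le> a\<^sup>2"
        using mult_left_mono[of "(u $ i - x $ i)\<^sup>2" 1 "a\<^sup>2"] by (simp add: power_mult_distrib)
      then have "((real (h i) - real n * x $ i) + a * (u $ i - x $ i))\<^sup>2 \<le> 2 * ((real (h i) - real n * x $ i)\<^sup>2 + a\<^sup>2)"
        by (intro order_trans[OF sq]) auto
      then show "(node a n h u $ i - x $ i)\<^sup>2 \<le> 2 * ((real (h i) - real n * x $ i)\<^sup>2 + a\<^sup>2) / (real n + a)\<^sup>2"
        unfolding eq power_divide by (rule divide_right_mono) auto
    qed
    finally show "(dist (node a n h u) x)\<^sup>2 \<le> ?b h" .
  qed
  also have "\<dots> = (\<Sum>i\<in>(UNIV::'n set). \<Sum>h\<in>multi_idx n. Pstar n h x * (2 * ((real (h i) - real n * x $ i)\<^sup>2 + a\<^sup>2) / (real n + a)\<^sup>2))"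
    unfolding sum_distrib_left by (rule sum.swap)
  also have "\<dots> \<le> (\<Sum>i\<in>(UNIV::'n set). 2 * (1 + a) / (real n + a))"
  proof (rule sum_mono)
    fix i
    have "(\<Sum>h\<in>multi_idx n. Pstar n h x * (2 * ((real (h i) - real n * x $ i)\<^sup>2 + a\<^sup>2) / (real n + a)\<^sup>2)) =
      2 / (real n + a)\<^sup>2 * ((\<Sum>h\<in>multi_idx n. Pstar n h x * (real (h i) - real n * x $ i)\<^sup>2) + a\<^sup>2 * (\<Sum>h\<in>multi_idx n. Pstar n h x))"
      unfolding sum_distrib_left sum.distrib[symmetric] by (intro sum.cong) (auto simp: algebra_simps add_divide_distrib)
    also have "\<dots> = 2 / (real n + a)\<^sup>2 * (real n * (x $ i * (1 - x $ i)) + a\<^sup>2)"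
      by (simp add: Pstar_variance sum_Pstar mult.assoc)
    also have "\<dots> \<le> 2 / (real n + a)\<^sup>2 * (real n * 1 + a\<^sup>2)"
      using simplexK_bounds[OF x, of i] by (intro mult_left_mono add_mono mult_le_one) auto
    \<comment> \<open>The product \<open>(1 + a) * (n + a)\<close> exceeds \<open>n + a^2\<close> by
      \<open>a + a * n\<close>, and it cancels one power of the denominator.\<close>
    also have "\<dots> \<le> 2 / (real n + a)\<^sup>2 * ((1 + a) * (real n + a))"
      using a by (intro mult_left_mono) (auto simp: power2_eq_square algebra_simps)
    also have "\<dots> = 2 * (1 + a) / (real n + a)"
      using a by (simp add: power2_eq_square)
    finally show "(\<Sum>h\<in>multi_idx n. Pstar n h x * (2 * ((real (h i) - real n * x $ i)\<^sup>2 + a\<^sup>2) / (real n + a)\<^sup>2))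
        \<le> 2 * (1 + a) / (real n + a)" .
  qed
  finally show ?thesis by simp
qed

text \<open>Korovkin's argument: uniform continuity and boundedness put \<open>g\<close> between two
  paraboloids with vertex at \<open>x\<close>, on which the operator is controlled by its values on
  constants and on the squared distance.\<close>

lemma Cop_uniform_limit:
  fixes g :: "real^'n::finite \<Rightarrow> real"
  assumes g: "continuous_on simplexK g" and e: "e > 0"
  shows "\<forall>\<^sub>F n in sequentially. \<forall>x\<in>simplexK. \<bar>Cop a n g x - g x\<bar> \<le> e"
proof -
  have int: "integrable (lebesgue_on simplexK) g"
    by (intro integrable_compact_continuous compact_simplexK g)
  obtain B where B: "\<And>y. y \<in> simplexK \<Longrightarrow> \<bar>g y\<bar> \<le> B" and "B > 0"
    using compact_imp_bounded[OF compact_continuous_image[OF g compact_simplexK]]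
    unfolding bounded_pos by auto
  obtain d where d: "d > 0" "\<And>x y. x \<in> simplexK \<Longrightarrow> y \<in> simplexK \<Longrightarrow> dist y x < d \<Longrightarrow> dist (g y) (g x) < e / 2"
    using compact_uniformly_continuous[OF g compact_simplexK] e
    unfolding uniformly_continuous_on_def by (metis half_gt_zero)
  \<comment> \<open>With this \<open>c\<close>, at distance at least \<open>d\<close> the quadratic
    term alone reaches \<open>2 * B\<close>, the largest possible difference of two values of
    \<open>g\<close>.\<close>
  define c where "c = 2 * B / d\<^sup>2"
  have c: "c \<ge> 0" using \<open>B > 0\<close> by (simp add: c_def)
  have key: "\<bar>g y - g x\<bar> \<le> e / 2 + c * (dist y x)\<^sup>2" if "x \<in> simplexK" "y \<in> simplexK" for x y
  proof (cases "dist y x < d")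
    case True
    then show ?thesis using d(2)[OF that True] c by (simp add: dist_real_def add_increasing2)
  next
    case False
    then have "d\<^sup>2 \<le> (dist y x)\<^sup>2"
      using d(1) by (intro power_mono) auto
    then have "c * d\<^sup>2 \<le> c * (dist y x)\<^sup>2"
      using c by (rule mult_left_mono)
    moreover have "c * d\<^sup>2 = 2 * B"
      using d(1) by (simp add: c_def)
    ultimately show ?thesis
      using B[OF that(1)] B[OF that(2)] e by linarith
  qed
  let ?r = "\<lambda>n::nat. c * (real CARD('n) * (2 * (1 + a) / (real n + a)))"
  have "filterlim (\<lambda>n. real n + a) at_top sequentially"
    by (subst add.commute) (rule filterlim_tendsto_add_at_top[OF tendsto_const filterlim_real_sequentially])
  then have "?r \<longlonglongrightarrow> c * (real CARD('n) * 0)"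
    by (intro tendsto_mult tendsto_const tendsto_divide_0[OF tendsto_const] filterlim_at_top_imp_at_infinity)
  then have "\<forall>\<^sub>F n in sequentially. ?r n < e / 2"
    using e by (intro order_tendstoD(2)) auto
  then show ?thesis
  proof eventually_elim
    case (elim n)
    show ?case
    proof
      fix x :: "real^'n" assume x: "x \<in> simplexK"
      have D: "integrable (lebesgue_on simplexK) (\<lambda>y. (dist y x)\<^sup>2)"
        by (intro integrable_compact_continuous compact_simplexK continuous_intros)
      \<comment> \<open>\<open>C\<close> is left free because it is used with
        \<open>g x + e / 2\<close> for the upper estimate and with \<open>- g x + e / 2\<close> for
        the lower one.\<close>
      have bound: "Cop a n (\<lambda>y. C + c * (dist y x)\<^sup>2) x \<le> C + e / 2" for C
      proof -
        have "Cop a n (\<lambda>y. C + c * (dist y x)\<^sup>2) x = C + c * Cop a n (\<lambda>y. (dist y x)\<^sup>2) x"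
          using D by (subst Cop_add) (auto simp: Cop_const Cop_cmult)
        also have "\<dots> \<le> C + ?r n"
          using c by (intro add_left_mono mult_left_mono Cop_dist_square_le x)
        also have "\<dots> \<le> C + e / 2" using elim by (intro add_left_mono less_imp_le)
        finally show ?thesis .
      qed
      have "Cop a n g x \<le> Cop a n (\<lambda>y. (g x + e / 2) + c * (dist y x)\<^sup>2) x"
        using D int key[OF x] by (intro Cop_mono x) (auto simp: abs_le_iff, smt (verit))
      then have up: "Cop a n g x \<le> g x + e"
        using bound[of "g x + e / 2"] by simp
      have "Cop a n (\<lambda>y. (- 1) * g y) x \<le> Cop a n (\<lambda>y. (- g x + e / 2) + c * (dist y x)\<^sup>2) x"
        using D int key[OF x] by (intro Cop_mono x) (auto simp: abs_le_iff, smt (verit))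
      then have "- Cop a n g x \<le> - g x + e"
        using bound[of "- g x + e / 2"] unfolding Cop_cmult by simp
      with up show "\<bar>Cop a n g x - g x\<bar> \<le> e" by linarith
    qed
  qed
qed

end

subsection \<open>Density of continuous functions and the main estimate\<close>

lemma tendsto_ennreal_0I:
  fixes F :: "'a \<Rightarrow> ennreal"
  assumes "\<And>e::real. e > 0 \<Longrightarrow> \<forall>\<^sub>F n in G. F n \<le> ennreal e"
  shows "(F \<longlongrightarrow> 0) G"
proof (rule order_tendstoI)
  fix b :: ennreal assume "0 < b"
  then obtain r where r: "0 < r" "r < b" using dense by blast
  then obtain e where e: "r = ennreal e" "e > 0"
    by (cases r) auto
  show "\<forall>\<^sub>F n in G. F n < b"
    using assms[OF e(2)] by eventually_elim (use r e in auto)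
qed simp

text \<open>Truncation to the interval from \<open>-k\<close> to \<open>k\<close>. Being continuous,
  it commutes with limits and preserves continuity of approximants while supplying the bound needed
  for dominated convergence.\<close>

definition clip :: "real \<Rightarrow> real \<Rightarrow> real" where
  "clip k t = max (- k) (min k t)"

lemma abs_clip_le: "0 \<le> k \<Longrightarrow> \<bar>clip k t\<bar> \<le> k"
  by (auto simp: clip_def)

lemma clip_eq: "\<bar>t\<bar> \<le> k \<Longrightarrow> clip k t = t"
  by (auto simp: clip_def)

lemma abs_diff_clip_le: "0 \<le> k \<Longrightarrow> \<bar>t - clip k t\<bar> \<le> \<bar>t\<bar>"
  by (auto simp: clip_def)

lemma continuous_clip: "continuous_on S (clip k)"
  unfolding clip_def by (intro continuous_intros)

lemma borel_measurable_clip [measurable]: "clip k \<in> borel_measurable borel"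
  by (intro borel_measurable_continuous_onI continuous_clip)

text \<open>Almost everywhere approximation by continuous functions lacks a dominating function, so
  both \<open>f\<close> and its approximants are clipped at one height \<open>k\<close>. The
  truncation error of \<open>f\<close> is dominated by \<open>\<bar>f\<bar> powr p\<close>, the
  remaining one by a constant on a set of finite measure. The result is a clipped
  approximant.\<close>

lemma continuous_approx_powr:
  fixes f :: "'a::euclidean_space \<Rightarrow> real"
  assumes S: "S \<in> sets lebesgue" "emeasure lebesgue S < \<infinity>" and p: "p > 0"
    and f: "f \<in> borel_measurable (lebesgue_on S)"
    and fp: "integrable (lebesgue_on S) (\<lambda>x. \<bar>f x\<bar> powr p)" and e: "e > 0"
  obtains g where "continuous_on UNIV g"
    "(\<integral>\<^sup>+ x. ennreal (\<bar>f x - g x\<bar> powr p) \<partial>lebesgue_on S) \<le> ennreal e"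
proof -
  let ?M = "lebesgue_on S"
  \<comment> \<open>Each of the two errors is allowed \<open>e / ?c\<close>; their sum is multiplied
    by \<open>2 powr p\<close> when the power of the total error is split.\<close>
  let ?c = "2 * (2 powr p)"
  have ec: "0 < ennreal (e / ?c)" using e by simp
  have fin: "(\<integral>\<^sup>+ x. ennreal K \<partial>?M) < \<infinity>" for K
    using S by (simp add: emeasure_restrict_space space_restrict_space ennreal_mult_less_top)
  have "(\<lambda>k. \<integral>\<^sup>+ x. ennreal (\<bar>f x - clip (real k) (f x)\<bar> powr p) \<partial>?M) \<longlonglongrightarrow> (\<integral>\<^sup>+ x. 0 \<partial>?M)"
  proof (rule nn_integral_dominated_convergence[where w = "\<lambda>x. ennreal (\<bar>f x\<bar> powr p)"])
    show "(\<integral>\<^sup>+ x. ennreal (\<bar>f x\<bar> powr p) \<partial>?M) < \<infinity>"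
      using fp by (simp add: integrable_iff_bounded)
    show "AE x in ?M. ennreal (\<bar>f x - clip (real k) (f x)\<bar> powr p) \<le> ennreal (\<bar>f x\<bar> powr p)" for k
      using p by (intro AE_I2 ennreal_leI powr_mono2 abs_diff_clip_le) auto
    show "AE x in ?M. (\<lambda>k. ennreal (\<bar>f x - clip (real k) (f x)\<bar> powr p)) \<longlonglongrightarrow> 0"
    proof (rule AE_I2)
      fix x
      have "\<forall>\<^sub>F k in sequentially. \<bar>f x\<bar> \<le> real k"
        using filterlim_real_sequentially by (simp add: filterlim_at_top)
      then have "\<forall>\<^sub>F k in sequentially. ennreal (\<bar>f x - clip (real k) (f x)\<bar> powr p) = 0"
        by eventually_elim (simp add: clip_eq)
      then show "(\<lambda>k. ennreal (\<bar>f x - clip (real k) (f x)\<bar> powr p)) \<longlonglongrightarrow> 0"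
        by (rule tendsto_eventually)
    qed
  qed (use f in measurable)
  then have "\<forall>\<^sub>F k in sequentially. (\<integral>\<^sup>+ x. ennreal (\<bar>f x - clip (real k) (f x)\<bar> powr p) \<partial>?M) < ennreal (e / ?c)"
    using ec by (intro order_tendstoD(2)[where y = 0]) auto
  then obtain k :: nat where k: "(\<integral>\<^sup>+ x. ennreal (\<bar>f x - clip (real k) (f x)\<bar> powr p) \<partial>?M) < ennreal (e / ?c)"
    by (auto simp: eventually_sequentially)
  \<comment> \<open>This notion of measurability directly provides continuous functions converging
    to \<open>f\<close> off a negligible set.\<close>
  have "f measurable_on S"
    using f S by (simp add: measurable_on_iff_borel_measurable)
  then obtain N g where N: "negligible N" and g: "\<And>n. continuous_on UNIV (g n)"
    and lim: "\<And>x. x \<notin> N \<Longrightarrow> (\<lambda>n::nat. g n x) \<longlonglongrightarrow> (if x \<in> S then f x else 0)"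
    unfolding measurable_on_def by metis
  have gm: "g n \<in> borel_measurable ?M" for n
    using borel_measurable_continuous_onI[OF g] by (intro measurable_restrict_space1 measurable_completion) auto
  have "(\<lambda>n. \<integral>\<^sup>+ x. ennreal (\<bar>clip (real k) (f x) - clip (real k) (g n x)\<bar> powr p) \<partial>?M) \<longlonglongrightarrow> (\<integral>\<^sup>+ x. 0 \<partial>?M)"
  proof (rule nn_integral_dominated_convergence[where w = "\<lambda>x. ennreal ((2 * real k) powr p)"])
    show "AE x in ?M. ennreal (\<bar>clip (real k) (f x) - clip (real k) (g n x)\<bar> powr p) \<le> ennreal ((2 * real k) powr p)" for n
    proof (intro AE_I2 ennreal_leI powr_mono2)
      fix x
      show "\<bar>clip (real k) (f x) - clip (real k) (g n x)\<bar> \<le> 2 * real k"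
        using abs_clip_le[of k "f x"] abs_clip_le[of k "g n x"] by auto
    qed (use p in auto)
    have "AE x in lebesgue. x \<notin> N"
      using N by (intro AE_not_in) (simp add: negligible_iff_null_sets)
    then have "AE x in ?M. x \<in> S \<and> x \<notin> N"
      using S by (subst AE_restrict_space_iff) auto
    then show "AE x in ?M. (\<lambda>n. ennreal (\<bar>clip (real k) (f x) - clip (real k) (g n x)\<bar> powr p)) \<longlonglongrightarrow> 0"
    proof eventually_elim
      case (elim x)
      then have "(\<lambda>n. g n x) \<longlonglongrightarrow> f x" using lim[of x] by simp
      then have "(\<lambda>n. clip (real k) (g n x)) \<longlonglongrightarrow> clip (real k) (f x)"
        unfolding clip_def by (intro tendsto_intros)
      then have "(\<lambda>n. \<bar>clip (real k) (f x) - clip (real k) (g n x)\<bar>) \<longlonglongrightarrow> \<bar>clip (real k) (f x) - clip (real k) (f x)\<bar>"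
        by (intro tendsto_intros)
      then have "(\<lambda>n. \<bar>clip (real k) (f x) - clip (real k) (g n x)\<bar> powr p) \<longlonglongrightarrow> 0 powr p"
        using p by (intro tendsto_powr') auto
      then show ?case
        using tendsto_ennrealI[of "\<lambda>n. \<bar>clip (real k) (f x) - clip (real k) (g n x)\<bar> powr p" 0] by simp
    qed
  next
    show "(\<lambda>x. ennreal (\<bar>clip (real k) (f x) - clip (real k) (g n x)\<bar> powr p)) \<in> borel_measurable ?M" for n
      using f gm by measurable
  qed (auto simp only: fin borel_measurable_const)
  then have "\<forall>\<^sub>F n in sequentially. (\<integral>\<^sup>+ x. ennreal (\<bar>clip (real k) (f x) - clip (real k) (g n x)\<bar> powr p) \<partial>?M) < ennreal (e / ?c)"
    using ec by (intro order_tendstoD(2)[where y = 0]) auto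
  then obtain n where n: "(\<integral>\<^sup>+ x. ennreal (\<bar>clip (real k) (f x) - clip (real k) (g n x)\<bar> powr p) \<partial>?M) < ennreal (e / ?c)"
    by (auto simp: eventually_sequentially)
  let ?u = "\<lambda>x. f x - clip (real k) (f x)" and ?v = "\<lambda>x. clip (real k) (f x) - clip (real k) (g n x)"
  note [measurable] = f gm
  have "(\<integral>\<^sup>+ x. ennreal (\<bar>f x - clip (real k) (g n x)\<bar> powr p) \<partial>?M) \<le>
     (\<integral>\<^sup>+ x. ennreal (2 powr p) * (ennreal (\<bar>?u x\<bar> powr p) + ennreal (\<bar>?v x\<bar> powr p)) \<partial>?M)"
  proof (rule nn_integral_mono)
    fix x
    show "ennreal (\<bar>f x - clip (real k) (g n x)\<bar> powr p) \<le> ennreal (2 powr p) * (ennreal (\<bar>?u x\<bar> powr p) + ennreal (\<bar>?v x\<bar> powr p))"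
      using abs_add_powr_le[of p "?u x" "?v x"] p
      by (simp add: ennreal_plus[symmetric] ennreal_mult'[symmetric] ennreal_leI del: ennreal_plus)
  qed
  also have "\<dots> = ennreal (2 powr p) * ((\<integral>\<^sup>+ x. ennreal (\<bar>?u x\<bar> powr p) \<partial>?M) + (\<integral>\<^sup>+ x. ennreal (\<bar>?v x\<bar> powr p) \<partial>?M))"
    by (subst nn_integral_cmult, measurable) (subst nn_integral_add, auto)
  also have "\<dots> \<le> ennreal (2 powr p) * (ennreal (e / ?c) + ennreal (e / ?c))"
    using k n by (intro mult_left_mono add_mono) auto
  also have "\<dots> = ennreal e"
    using e by (simp add: ennreal_plus[symmetric] ennreal_mult'[symmetric] del: ennreal_plus)
  finally have "(\<integral>\<^sup>+ x. ennreal (\<bar>f x - clip (real k) (g n x)\<bar> powr p) \<partial>?M) \<le> ennreal e" .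
  moreover have "continuous_on UNIV (\<lambda>x. clip (real k) (g n x))"
    by (rule continuous_on_compose2[OF continuous_clip[of UNIV] g]) auto
  ultimately show thesis using that by blast
qed

theorem theorem4p4:
  fixes f :: "real^'n::finite \<Rightarrow> real" and a p :: real
  assumes "a > 0" and "1 \<le> p"
    and "f \<in> borel_measurable (lebesgue_on simplexK)"
    and "integrable (lebesgue_on simplexK) (\<lambda>x. \<bar>f x\<bar> powr p)"
  shows "(\<lambda>n. \<integral>\<^sup>+ x. ennreal (\<bar>Cop a n f x - f x\<bar> powr p) \<partial>(lebesgue_on simplexK))
           \<longlonglongrightarrow> 0"
proof (rule tendsto_ennreal_0I)
  fix e :: real assume e: "e > 0"
  let ?M = "lebesgue_on simplexK :: (real^'n) measure"
  \<comment> \<open>Two applications of \<open>abs_add_powr_le\<close> split the error into three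
    terms.\<close>
  let ?c = "2 powr p * 2 powr p"
  define C where "C = fact CARD('n) * ((1 + a)\<^sup>2 / a) ^ CARD('n)"
  have C: "C \<ge> 0" using assms(1) by (simp add: C_def)
  \<comment> \<open>Chosen so that \<open>?c * ((C + 1) * d)\<close> is half of \<open>e\<close>:
    the share \<open>C\<close> pays for the operator applied to \<open>f - g\<close>, the 1 for
    \<open>f - g\<close> itself.\<close>
  define d where "d = e / (2 * ?c * (C + 1))"
  have d: "d > 0" using e C by (simp add: d_def)
  \<comment> \<open>The uniform error for \<open>g\<close>, with \<open>?c * r powr p\<close> the
    other half of \<open>e\<close>; it can be integrated at no cost because the simplex has volume
    at most 1.\<close>
  define r where "r = (e / (2 * ?c)) powr (1 / p)"
  have r: "r > 0" "r powr p = e / (2 * ?c)"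
    using e assms(2) by (auto simp: r_def powr_powr)
  obtain g where g: "continuous_on UNIV g"
    and fg: "(\<integral>\<^sup>+ x. ennreal (\<bar>f x - g x\<bar> powr p) \<partial>?M) \<le> ennreal d"
  proof (rule continuous_approx_powr[where S = simplexK and p = p and f = f and e = d])
    show "emeasure lebesgue (simplexK :: (real^'n) set) < \<infinity>"
      by (simp add: emeasure_simplexK)
  qed (use assms d in auto)
  have g': "continuous_on simplexK g"
    using g by (rule continuous_on_subset) auto
  have gi: "integrable ?M g"
    by (intro integrable_compact_continuous compact_simplexK g')
  have fi: "integrable ?M f"
    by (rule integrable_of_powr[OF assms(2-4)])
  let ?h = "\<lambda>x. f x - g x"
  have hm[measurable]: "?h \<in> borel_measurable ?M"
    by (intro borel_measurable_diff borel_measurable_integrable fi gi)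
  have hi: "integrable ?M (\<lambda>x. \<bar>?h x\<bar> powr p)"
    using le_less_trans[OF fg, of \<infinity>] by (intro integrableI_bounded) auto
  have bnd: "(\<integral>\<^sup>+ x. ennreal (\<bar>Cop a n ?h x\<bar> powr p) \<partial>?M) \<le> ennreal (C * d)" for n
  proof -
    have "(\<integral>\<^sup>+ x. ennreal (\<bar>Cop a n ?h x\<bar> powr p) \<partial>?M) \<le> (\<integral>\<^sup>+ x. ennreal (Cop a n (\<lambda>x. \<bar>?h x\<bar> powr p) x) \<partial>?M)"
      using Cop_powr_le[OF assms(1,2) hm hi] by (intro nn_integral_mono ennreal_leI) (auto simp: space_simplexK)
    also have "\<dots> \<le> ennreal C * (\<integral>\<^sup>+ x. ennreal (\<bar>?h x\<bar> powr p) \<partial>?M)"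
      unfolding C_def by (intro nn_integral_Cop_le assms hi) auto
    also have "\<dots> \<le> ennreal C * ennreal d"
      using fg by (intro mult_left_mono) auto
    finally show ?thesis using C by (simp add: ennreal_mult')
  qed
  have "emeasure ?M (space ?M) \<le> 1"
    by (simp add: space_simplexK emeasure_restrict_space emeasure_simplexK)
  then have const_le: "(\<integral>\<^sup>+ x. ennreal (r powr p) \<partial>?M) \<le> ennreal (r powr p)"
    using mult_left_mono[of "emeasure ?M (space ?M)" 1 "ennreal (r powr p)"] by simp
  have "\<forall>\<^sub>F n in sequentially. \<forall>x\<in>simplexK. \<bar>Cop a n g x - g x\<bar> \<le> r"
    by (rule Cop_uniform_limit[OF assms(1) g' r(1)])
  then show "\<forall>\<^sub>F n in sequentially. (\<integral>\<^sup>+ x. ennreal (\<bar>Cop a n f x - f x\<bar> powr p) \<partial>?M) \<le> ennreal e"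
  proof eventually_elim
    case (elim n)
    let ?A = "\<lambda>x. \<bar>Cop a n ?h x\<bar> powr p" and ?B = "\<lambda>x. \<bar>?h x\<bar> powr p"
    have [measurable]: "Cop a n ?h \<in> borel_measurable ?M"
      by (rule borel_measurable_Cop[OF assms(1)])
    have "(\<integral>\<^sup>+ x. ennreal (\<bar>Cop a n f x - f x\<bar> powr p) \<partial>?M) \<le>
      (\<integral>\<^sup>+ x. ennreal ?c * (ennreal (?A x) + (ennreal (r powr p) + ennreal (?B x))) \<partial>?M)"
    proof (rule nn_integral_mono)
      fix x assume "x \<in> space ?M"
      then have x: "x \<in> simplexK" by (simp add: space_simplexK)
      have "Cop a n f x = Cop a n ?h x + Cop a n g x"
        using Cop_add[OF assms(1), of ?h g n x] fi gi by simp
      then have "\<bar>Cop a n f x - f x\<bar> powr p = \<bar>Cop a n ?h x + ((Cop a n g x - g x) + - ?h x)\<bar> powr p"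
        by (simp add: algebra_simps)
      also have "\<dots> \<le> 2 powr p * (?A x + \<bar>(Cop a n g x - g x) + - ?h x\<bar> powr p)"
        using assms(2) by (intro abs_add_powr_le) auto
      also have "\<dots> \<le> 2 powr p * (?A x + 2 powr p * (\<bar>Cop a n g x - g x\<bar> powr p + \<bar>- ?h x\<bar> powr p))"
        using assms(2) by (intro mult_left_mono add_left_mono abs_add_powr_le) auto
      \<comment> \<open>The first term is enlarged by \<open>2 powr p\<close> only to give all three
        terms the common factor \<open>?c\<close>.\<close>
      also have "\<dots> \<le> 2 powr p * (2 powr p * ?A x + 2 powr p * (r powr p + ?B x))"
      proof (intro mult_left_mono add_mono)
        show "?A x \<le> 2 powr p * ?A x"
          using mult_right_mono[of 1 "2 powr p" "?A x"] assms(2) by (simp add: ge_one_powr_ge_zero)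
        show "\<bar>Cop a n g x - g x\<bar> powr p \<le> r powr p"
          using elim x assms(2) by (intro powr_mono2) auto
      qed (auto simp: abs_minus_commute)
      also have "\<dots> = ?c * (?A x + (r powr p + ?B x))"
        by (simp add: algebra_simps)
      finally show "ennreal (\<bar>Cop a n f x - f x\<bar> powr p) \<le> ennreal ?c * (ennreal (?A x) + (ennreal (r powr p) + ennreal (?B x)))"
        by (simp add: ennreal_plus[symmetric] ennreal_mult'[symmetric] ennreal_leI del: ennreal_plus)
    qed
    also have "\<dots> = ennreal ?c * ((\<integral>\<^sup>+ x. ennreal (?A x) \<partial>?M) + ((\<integral>\<^sup>+ x. ennreal (r powr p) \<partial>?M) + (\<integral>\<^sup>+ x. ennreal (?B x) \<partial>?M)))"
      by (subst nn_integral_cmult, measurable) (subst nn_integral_add, measurable, subst nn_integral_add, measurable)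
    also have "\<dots> \<le> ennreal ?c * (ennreal (C * d) + (ennreal (r powr p) + ennreal d))"
      by (intro mult_left_mono add_mono bnd fg const_le) auto
    also have "\<dots> = ennreal (?c * (C * d + (r powr p + d)))"
      using C d by (simp add: ennreal_plus[symmetric] ennreal_mult'[symmetric] del: ennreal_plus)
    also have "?c * (C * d + (r powr p + d)) = ?c * ((C + 1) * d) + ?c * r powr p"
      by (simp add: algebra_simps)
    also have "(C + 1) * d = e / (2 * ?c)"
      using C by (simp add: d_def)
    also have "?c * (e / (2 * ?c)) + ?c * r powr p = e"
      by (simp add: r(2))
    finally show ?case .
  qed
qed

end
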